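(* Let $\{\boldsymbol{\lambda}^j\}$ be the infinite sequence generated by the semismooth Newton algorithm described in the context (run without the stopping test). Then $\{\boldsymbol{\lambda}^j\} \subseteq \mathrm{Ran}(\mathcal{M})$ is a bounded sequence, and any accumulation point of it is an optimal solution of the dual problem $\max_{\boldsymbol{\lambda} \in \mathrm{Ran}(\mathcal{M})} \Phi(\boldsymbol{\lambda})$. Furthermore, let $\mathcal{K} = \{ k \in \mathcal{N}^d : (\boldsymbol{g}^* )_k > 0 \}$, where $\boldsymbol{g}^*$ is the unique minimizer of the primal problem, and assume $$\mathrm{span}\big( \{ \mathcal{M}_{:,k} \}_{k \in \mathcal{K}} \big) = \mathrm{Ran}(\mathcal{M}),$$ where $\mathcal{M}_{:,k}$ is the $k$th column of $\mathcal{M}$. Then the sequence $\{\boldsymbol{\lambda}^j\}$ converges to an optimal solution $\boldsymbol{\lambda}^*$ of the dual problem, and $$\| \boldsymbol{\lambda}^{j+1} - \boldsymbol{\lambda}^* \| \le \mathcal{O}\big( \| \boldsymbol{\lambda}^j - \boldsymbol{\lambda}^* \|^2 \big).$$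
   Context: Fix $d \ge 1$ and $N \in \mathbb{N}$. Let $\mathcal{N} = \{-N,\dots,N\}$, $x_k = 2\pi k/(2N+1)$ for $k \in \mathcal{N}^d$, and let $\mathbb{S}^N$ be the space of real-valued functions in $\mathrm{span}\{e^{ik\cdot x} : k \in \mathcal{N}^d\}$. For $g \in L^2((-\pi,\pi)^d)$ let $\mathcal{P}^N g = \sum_{k \in \mathcal{N}^d} \hat g_k e^{ik\cdot x}$ with $\hat g_k = (2\pi)^{-d}\int_{[-\pi,\pi]^d} g(x) e^{-ik\cdot x}\,\mathrm{d}x$. Let $\boldsymbol{m}(x) = (m_1(x),\dots,m_M(x))^{\intercal}$ be a vector of $M$ linearly independent real polynomials on $\mathbb{R}^d$, one of which is a nonzero constant. Let $f \ge 0$ be a real-valued $2\pi$-periodic function in $L^2([-\pi,\pi]^d)$ and $\boldsymbol{\rho}(f) = \int_{[-\pi,\pi]^d} \boldsymbol{m}(x) f(x)\,\mathrm{d}x \in \mathbb{R}^M$. Vectors in $\mathbb{R}^{(2N+1)^d}$ are indexed by $k \in \mathcal{N}^d$. Let $\boldsymbol{f}_N$ be the vector with entries $(\mathcal{P}^N f)(x_k)$, and let $\mathcal{M} \in \mathbb{R}^{M \times (2N+1)^d}$ be the matrix with entries $\mathcal{M}_{j,k} = \frac{(2\pi)^d}{(2N+1)^d}\, \mathcal{P}^N m_j(x_k)$ (row index $j$, column index $k$). $\mathrm{Ran}(\mathcal{M}) \subseteq \mathbb{R}^M$ is its range, $\|\cdot\|$ and $\|\cdot\|_2$ denote the Euclidean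 norm, and $\langle\cdot,\cdot\rangle$ between vectors is the Euclidean inner product. Standing assumption: there exists $g \in \mathbb{S}^N$ with $g(x_k) > 0$ for all $k \in \mathcal{N}^d$ and $\frac{(2\pi)^d}{(2N+1)^d}\sum_{k \in \mathcal{N}^d} g(x_k)\, \mathcal{P}^N \boldsymbol{m}(x_k) = \boldsymbol{\rho}(f)$. Primal problem: $\min_{\boldsymbol{g}} \|\boldsymbol{g} - \boldsymbol{f}_N\|_2^2$ subject to $\boldsymbol{g} \in \mathbb{R}_+^{(2N+1)^d}$ (nonnegative orthant) and $\mathcal{M}\boldsymbol{g} = \boldsymbol{\rho}(f)$; its unique minimizer is denoted $\boldsymbol{g}^*$. Dual problem: $\max_{\boldsymbol{\lambda} \in \mathrm{Ran}(\mathcal{M})} \Phi(\boldsymbol{\lambda})$, where $$\Phi(\boldsymbol{\lambda}) = -\left\| \Pi_+\!\left(\boldsymbol{f}_N + \tfrac12 \mathcal{M}^{\intercal}\boldsymbol{\lambda}\right)\right\|_2^2 + \boldsymbol{\lambda}^{\intercal}\boldsymbol{\rho}(f) + \|\boldsymbol{f}_N\|_2^2, \qquad (\Pi_+(\boldsymbol{w}))_k = \max(0,w_k).$$ $\Phi$ is continuously differentiable with $\nabla\Phi(\boldsymbol{\lambda}) = -\mathcal{M}\,\Pi_+(\boldsymbol{f}_N + \tfrac12\mathcal{M}^{\intercal}\boldsymbol{\lambda}) + \boldsymbol{\rho}(f)$. Algorithm: Fix parameters $\tau_1,\tau_2 \in (0,1)$, $\mu \in (0,1/2)$, $\delta \in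 (0,1)$. Set $\boldsymbol{\lambda}^0 = \boldsymbol{0} \in \mathbb{R}^M$. For $j = 0,1,2,\dots$: Step 1 (Newton direction). Let $\boldsymbol{u}^j \in \mathbb{R}^{(2N+1)^d}$ have entries $(\boldsymbol{u}^j)_k = 1$ if $(\boldsymbol{f}_N + \frac12\mathcal{M}^{\intercal}\boldsymbol{\lambda}^j)_k > 0$ and $(\boldsymbol{u}^j)_k = 0$ otherwise. Set $\varepsilon_j = \tau_1\min\{\tau_2, \|\nabla\Phi(\boldsymbol{\lambda}^j)\|\}$ and let $\boldsymbol{d}^j \in \mathrm{Ran}(\mathcal{M})$ solve $$\left(-\tfrac12\mathcal{M}\,\mathrm{Diag}(\boldsymbol{u}^j)\,\mathcal{M}^{\intercal} - \varepsilon_j I_M\right)\boldsymbol{d} = -\nabla\Phi(\boldsymbol{\lambda}^j),$$ where $I_M$ is the $M\times M$ identity matrix. Step 2 (line search). Let $n_j$ be the smallest nonnegative integer $n$ for which $\Phi(\boldsymbol{\lambda}^j + \delta^n\boldsymbol{d}^j) \ge \Phi(\boldsymbol{\lambda}^j) + \mu\,\delta^n\langle\nabla\Phi(\boldsymbol{\lambda}^j),\boldsymbol{d}^j\rangle$. Step 3. Set $\boldsymbol{\lambda}^{j+1} = \boldsymbol{\lambda}^j + \delta^{n_j}\boldsymbol{d}^j$. The $\mathcal{O}$ bound means: there is a constant $C$ such that $\|\boldsymbol{\lambda}^{j+1}-\boldsymbol{\lambda}^*\| \le C\|\boldsymbol{\lambda}^j-\boldsymbol{\lambda}^*\|^2$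 for all sufficiently large $j$. *)

theory Defs
  imports "HOL-Analysis.Analysis"
begin

(* The dimension d is CARD('d) and the number M of moment polynomials is CARD('m).
   A vector in R^((2N+1)^d), indexed by the multi-indices in grid N, is a function
   "int^'d => real" of which only the values on grid N matter. *)

definition grid :: "nat \<Rightarrow> (int^'d) set" where
  "grid N = {k. \<forall>i. k $ i \<in> {- int N..int N}}"

definition freq :: "int^'d \<Rightarrow> real^'d" where
  "freq k = (\<chi> i. real_of_int (k $ i))"

definition node :: "nat \<Rightarrow> int^'d \<Rightarrow> real^'d" where
  "node N k = (2 * pi / real (2 * N + 1)) *\<^sub>R freq k"

definition fmode :: "int^'d \<Rightarrow> real^'d \<Rightarrow> complex" where
  "fmode k x = exp (\<i> * complex_of_real (freq k \<bullet> x))"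

definition box_pi :: "(real^'d) set" where
  "box_pi = cbox (\<chi> i. - pi) (\<chi> i. pi)"

definition square_integrable_box :: "(real^'d \<Rightarrow> real) \<Rightarrow> bool" where
  "square_integrable_box f \<longleftrightarrow>
     set_borel_measurable lebesgue box_pi f \<and> set_integrable lebesgue box_pi (\<lambda>x. (f x)\<^sup>2)"

definition periodic_2pi :: "(real^'d \<Rightarrow> real) \<Rightarrow> bool" where
  "periodic_2pi f \<longleftrightarrow> (\<forall>x i. f (x + (2 * pi) *\<^sub>R axis i 1) = f x)"

definition trig_space :: "nat \<Rightarrow> (real^'d \<Rightarrow> real) set" where
  "trig_space N = {g. \<exists>c :: int^'d \<Rightarrow> complex.
     \<forall>x. complex_of_real (g x) = (\<Sum>k\<in>grid N. c k * fmode k x)}"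

definition fourier_coeff :: "(real^'d \<Rightarrow> real) \<Rightarrow> int^'d \<Rightarrow> complex" where
  "fourier_coeff g k = complex_of_real (1 / (2 * pi) ^ CARD('d)) *
     (LINT x : box_pi | lebesgue. complex_of_real (g x) * exp (- \<i> * complex_of_real (freq k \<bullet> x)))"

definition fourier_proj :: "nat \<Rightarrow> (real^'d \<Rightarrow> real) \<Rightarrow> real^'d \<Rightarrow> complex" where
  "fourier_proj N g x = (\<Sum>k\<in>grid N. fourier_coeff g k * fmode k x)"

(* The projection of a real function is real-valued (see Im_fourier_proj), so that
   taking the real part only changes the type. *)
definition proj :: "nat \<Rightarrow> (real^'d \<Rightarrow> real) \<Rightarrow> real^'d \<Rightarrow> real" where
  "proj N g x = Re (fourier_proj N g x)"

definition cell_vol :: "nat \<Rightarrow> 'd::finite itself \<Rightarrow> real" where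
  "cell_vol N _ = (2 * pi) ^ CARD('d) / real ((2 * N + 1) ^ CARD('d))"

definition lin_indep_components :: "(real^'d \<Rightarrow> real^'m) \<Rightarrow> bool" where
  "lin_indep_components m \<longleftrightarrow> (\<forall>c :: real^'m. (\<forall>x. (\<Sum>j\<in>UNIV. c $ j * m x $ j) = 0) \<longrightarrow> c = 0)"

definition rho :: "(real^'d \<Rightarrow> real^'m) \<Rightarrow> (real^'d \<Rightarrow> real) \<Rightarrow> real^'m" where
  "rho m f = (LINT x : box_pi | lebesgue. f x *\<^sub>R m x)"

definition fvec :: "nat \<Rightarrow> (real^'d \<Rightarrow> real) \<Rightarrow> int^'d \<Rightarrow> real" where
  "fvec N f k = proj N f (node N k)"

definition mom_mat :: "nat \<Rightarrow> (real^'d \<Rightarrow> real^'m) \<Rightarrow> 'm \<Rightarrow> int^'d \<Rightarrow> real" where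
  "mom_mat N m j k = cell_vol N TYPE('d) * proj N (\<lambda>x. m x $ j) (node N k)"

definition mom_col :: "nat \<Rightarrow> (real^'d \<Rightarrow> real^'m) \<Rightarrow> int^'d \<Rightarrow> real^'m" where
  "mom_col N m k = (\<chi> j. mom_mat N m j k)"

definition mom_apply :: "nat \<Rightarrow> (real^'d \<Rightarrow> real^'m) \<Rightarrow> (int^'d \<Rightarrow> real) \<Rightarrow> real^'m" where
  "mom_apply N m g = (\<chi> j. \<Sum>k\<in>grid N. mom_mat N m j k * g k)"

definition mom_transpose :: "nat \<Rightarrow> (real^'d \<Rightarrow> real^'m) \<Rightarrow> real^'m \<Rightarrow> int^'d \<Rightarrow> real" where
  "mom_transpose N m l k = (\<Sum>j\<in>UNIV. mom_mat N m j k * l $ j)"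

definition Ran :: "nat \<Rightarrow> (real^'d \<Rightarrow> real^'m) \<Rightarrow> (real^'m) set" where
  "Ran N m = range (mom_apply N m)"

definition slater :: "nat \<Rightarrow> (real^'d \<Rightarrow> real^'m) \<Rightarrow> (real^'d \<Rightarrow> real) \<Rightarrow> bool" where
  "slater N m f \<longleftrightarrow> (\<exists>g\<in>trig_space N. (\<forall>k\<in>grid N. g (node N k) > 0) \<and>
     cell_vol N TYPE('d) *\<^sub>R
       (\<Sum>k\<in>grid N. g (node N k) *\<^sub>R (\<chi> j. proj N (\<lambda>x. m x $ j) (node N k))) = rho m f)"

(* The function space is extensional outside grid N, so that equality of feasible
   points is equality of vectors indexed by grid N. *)
definition primal_feasible ::
  "nat \<Rightarrow> (real^'d \<Rightarrow> real^'m) \<Rightarrow> (real^'d \<Rightarrow> real) \<Rightarrow> (int^'d \<Rightarrow> real) \<Rightarrow> bool" where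
  "primal_feasible N m f g \<longleftrightarrow> g \<in> grid N \<rightarrow>\<^sub>E {0..} \<and> mom_apply N m g = rho m f"

definition primal_minimizer ::
  "nat \<Rightarrow> (real^'d \<Rightarrow> real^'m) \<Rightarrow> (real^'d \<Rightarrow> real) \<Rightarrow> (int^'d \<Rightarrow> real) \<Rightarrow> bool" where
  "primal_minimizer N m f g \<longleftrightarrow>
     is_arg_min (\<lambda>g. (L2_set (\<lambda>k. g k - fvec N f k) (grid N))\<^sup>2) (primal_feasible N m f) g"

definition shifted ::
  "nat \<Rightarrow> (real^'d \<Rightarrow> real^'m) \<Rightarrow> (real^'d \<Rightarrow> real) \<Rightarrow> real^'m \<Rightarrow> int^'d \<Rightarrow> real" where
  "shifted N m f l k = fvec N f k + (1/2) * mom_transpose N m l k"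

definition pos_part :: "(int^'d \<Rightarrow> real) \<Rightarrow> int^'d \<Rightarrow> real" where
  "pos_part w k = max 0 (w k)"

definition dual_obj ::
  "nat \<Rightarrow> (real^'d \<Rightarrow> real^'m) \<Rightarrow> (real^'d \<Rightarrow> real) \<Rightarrow> real^'m \<Rightarrow> real" where
  "dual_obj N m f l =
     - (L2_set (pos_part (shifted N m f l)) (grid N))\<^sup>2 + l \<bullet> rho m f + (L2_set (fvec N f) (grid N))\<^sup>2"

definition dual_solution ::
  "nat \<Rightarrow> (real^'d \<Rightarrow> real^'m) \<Rightarrow> (real^'d \<Rightarrow> real) \<Rightarrow> real^'m \<Rightarrow> bool" where
  "dual_solution N m f l \<longleftrightarrow> is_arg_max (dual_obj N m f) (\<lambda>l. l \<in> Ran N m) l"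

(* This is indeed the gradient of dual_obj, see GDERIV_dual_obj. *)
definition dual_grad ::
  "nat \<Rightarrow> (real^'d \<Rightarrow> real^'m) \<Rightarrow> (real^'d \<Rightarrow> real) \<Rightarrow> real^'m \<Rightarrow> real^'m" where
  "dual_grad N m f l = - mom_apply N m (pos_part (shifted N m f l)) + rho m f"

definition active ::
  "nat \<Rightarrow> (real^'d \<Rightarrow> real^'m) \<Rightarrow> (real^'d \<Rightarrow> real) \<Rightarrow> real^'m \<Rightarrow> int^'d \<Rightarrow> real" where
  "active N m f l k = (if shifted N m f l k > 0 then 1 else 0)"

definition newton_mat ::
  "nat \<Rightarrow> (real^'d \<Rightarrow> real^'m) \<Rightarrow> (int^'d \<Rightarrow> real) \<Rightarrow> real \<Rightarrow> real^'m^'m" where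
  "newton_mat N m u \<epsilon> =
     - (1/2) *\<^sub>R (\<chi> i j. \<Sum>k\<in>grid N. mom_mat N m i k * u k * mom_mat N m j k) - mat \<epsilon>"

definition newton_direction ::
  "nat \<Rightarrow> (real^'d \<Rightarrow> real^'m) \<Rightarrow> (real^'d \<Rightarrow> real) \<Rightarrow> real \<Rightarrow> real \<Rightarrow> real^'m \<Rightarrow> real^'m \<Rightarrow> bool" where
  "newton_direction N m f \<tau>\<^sub>1 \<tau>\<^sub>2 l d \<longleftrightarrow> d \<in> Ran N m \<and>
     newton_mat N m (active N m f l) (\<tau>\<^sub>1 * min \<tau>\<^sub>2 (norm (dual_grad N m f l))) *v d = - dual_grad N m f l"

definition armijo ::
  "nat \<Rightarrow> (real^'d \<Rightarrow> real^'m) \<Rightarrow> (real^'d \<Rightarrow> real) \<Rightarrow> real \<Rightarrow> real \<Rightarrow> real^'m \<Rightarrow> real^'m \<Rightarrow> nat \<Rightarrow> bool" where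
  "armijo N m f \<mu> \<delta> l d n \<longleftrightarrow>
     dual_obj N m f (l + \<delta> ^ n *\<^sub>R d) \<ge> dual_obj N m f l + \<mu> * \<delta> ^ n * (dual_grad N m f l \<bullet> d)"

(* A relation rather than a function: at a point with zero gradient the Newton matrix may be
   singular, and the direction need not be unique (d = 0 is always possible there). *)
definition ssn_sequence ::
  "nat \<Rightarrow> (real^'d \<Rightarrow> real^'m) \<Rightarrow> (real^'d \<Rightarrow> real) \<Rightarrow>
   real \<Rightarrow> real \<Rightarrow> real \<Rightarrow> real \<Rightarrow> (nat \<Rightarrow> real^'m) \<Rightarrow> bool" where
  "ssn_sequence N m f \<tau>\<^sub>1 \<tau>\<^sub>2 \<mu> \<delta> lam \<longleftrightarrow> lam 0 = 0 \<and>
     (\<forall>j. \<exists>d n. newton_direction N m f \<tau>\<^sub>1 \<tau>\<^sub>2 (lam j) d \<and>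
        armijo N m f \<mu> \<delta> (lam j) d n \<and> (\<forall>i<n. \<not> armijo N m f \<mu> \<delta> (lam j) d i) \<and>
        lam (Suc j) = lam j + \<delta> ^ n *\<^sub>R d)"

definition accumulation_point :: "(nat \<Rightarrow> 'a::topological_space) \<Rightarrow> 'a \<Rightarrow> bool" where
  "accumulation_point X l \<longleftrightarrow> (\<exists>r :: nat \<Rightarrow> nat. strict_mono r \<and> (X \<circ> r) \<longlonglongrightarrow> l)"


lemma finite_grid: "finite (grid N :: (int^'d) set)"
proof -
  have "vec_nth ` (grid N :: (int^'d) set) \<subseteq> (UNIV :: 'd set) \<rightarrow>\<^sub>E {- int N..int N}"
    by (auto simp: grid_def)
  moreover have "finite ((UNIV :: 'd set) \<rightarrow>\<^sub>E {- int N..int N})"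
    by (intro finite_PiE) auto
  ultimately have "finite (vec_nth ` (grid N :: (int^'d) set))"
    by (rule finite_subset)
  thus ?thesis
    by (rule finite_imageD) (auto simp: inj_on_def vec_nth_inject)
qed

lemma Im_fourier_proj: "Im (fourier_proj N (g :: real^'d \<Rightarrow> real) x) = 0"
proof -
  have fr: "freq (- k) = - freq (k :: int^'d)" for k
    by (simp add: freq_def vec_eq_iff)
  have md: "cnj (fmode k x) = fmode (- k) x" for k :: "int^'d"
    by (simp add: fmode_def fr exp_cnj)
  have co: "cnj (fourier_coeff g k) = fourier_coeff g (- k)" for k
  proof -
    have "cnj (LINT x : box_pi | lebesgue. complex_of_real (g x) * exp (- \<i> * complex_of_real (freq k \<bullet> x)))
      = (LINT x : box_pi | lebesgue. cnj (complex_of_real (g x) * exp (- \<i> * complex_of_real (freq k \<bullet> x))))"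
      unfolding set_lebesgue_integral_def
      by (subst integral_bounded_linear'[OF bounded_linear_cnj bounded_linear_cnj, symmetric])
         (simp_all add: scaleR_conv_of_real)
    also have "\<dots> = (LINT x : box_pi | lebesgue. complex_of_real (g x) * exp (- \<i> * complex_of_real (freq (- k) \<bullet> x)))"
      by (simp add: fr exp_cnj)
    finally show ?thesis
      by (simp add: fourier_coeff_def)
  qed
  have "cnj (fourier_proj N g x) = (\<Sum>k\<in>grid N. fourier_coeff g (- k) * fmode (- k) x)"
    by (simp add: fourier_proj_def md co)
  also have "\<dots> = fourier_proj N g x"
    unfolding fourier_proj_def
    by (rule sum.reindex_bij_witness[of _ uminus uminus]) (auto simp: grid_def minus_le_iff le_minus_iff)
  finally show ?thesis
    by (metis complex_cnj_cancel_iff complex_cnj cnj.sel(2) equal_neg_zero)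
qed

lemma GDERIV_dual_obj: "GDERIV (dual_obj N m f) l :> dual_grad N m f l"
proof -
  have mx: "((\<lambda>t::real. (max 0 t)\<^sup>2) has_real_derivative 2 * max 0 t) (at t)" for t
  proof -
    have "\<bar>(max 0 y)\<^sup>2 - (max 0 t)\<^sup>2 - (2 * max 0 t) * (y - t)\<bar> \<le> (y - t)\<^sup>2" for y :: real
    proof (cases "y \<ge> 0"; cases "t \<ge> 0")
      assume *: "y \<ge> 0" "\<not> t \<ge> 0"
      hence "y\<^sup>2 \<le> (y - t)\<^sup>2" by (intro power_mono) auto
      with * show ?thesis by (simp add: max_def)
    next
      assume *: "\<not> y \<ge> 0" "t \<ge> 0"
      have "0 \<le> y\<^sup>2" "t * y \<le> 0" using * by (auto simp: mult_nonneg_nonpos)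
      moreover have "\<bar>(max 0 y)\<^sup>2 - (max 0 t)\<^sup>2 - (2 * max 0 t) * (y - t)\<bar> = \<bar>t\<^sup>2 - 2 * (t * y)\<bar>"
        using * by (simp add: max_def power2_eq_square algebra_simps)
      moreover have "0 \<le> t\<^sup>2" by simp
      moreover have "(y - t)\<^sup>2 = y\<^sup>2 + t\<^sup>2 - 2 * (t * y)" by (simp add: power2_eq_square algebra_simps)
      ultimately show ?thesis by linarith
    next
      assume *: "y \<ge> 0" "t \<ge> 0"
      have "(max 0 y)\<^sup>2 - (max 0 t)\<^sup>2 - (2 * max 0 t) * (y - t) = (y - t)\<^sup>2"
        using * by (simp add: max_def power2_eq_square algebra_simps)
      thus ?thesis by simp
    next
      assume *: "\<not> y \<ge> 0" "\<not> t \<ge> 0"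
      thus ?thesis by (simp add: max_def)
    qed
    note bnd = this
    have lim: "((\<lambda>y. \<bar>y - t\<bar>) \<longlongrightarrow> 0) (at t)"
      by (auto intro!: tendsto_eq_intros)
    have "((\<lambda>y. ((max 0 y)\<^sup>2 - (max 0 t)\<^sup>2) / (y - t) - 2 * max 0 t) \<longlongrightarrow> 0) (at t)"
    proof (rule Lim_null_comparison[OF _ lim])
      show "\<forall>\<^sub>F y in at t. norm (((max 0 y)\<^sup>2 - (max 0 t)\<^sup>2) / (y - t) - 2 * max 0 t) \<le> \<bar>y - t\<bar>"
      proof (rule eventually_at_topological[THEN iffD2], intro exI[of _ UNIV] conjI ballI impI)
        fix y assume "y \<noteq> t"
        hence eq: "((max 0 y)\<^sup>2 - (max 0 t)\<^sup>2) / (y - t) - 2 * max 0 t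
          = ((max 0 y)\<^sup>2 - (max 0 t)\<^sup>2 - (2 * max 0 t) * (y - t)) / (y - t)"
          by (simp add: diff_divide_distrib)
        show "norm (((max 0 y)\<^sup>2 - (max 0 t)\<^sup>2) / (y - t) - 2 * max 0 t) \<le> \<bar>y - t\<bar>"
          unfolding eq using bnd[of y] \<open>y \<noteq> t\<close>
          by (simp add: abs_divide divide_le_eq power2_eq_square abs_mult)
      qed auto
    qed
    thus ?thesis
      by (simp add: has_field_derivative_iff LIM_zero_iff)
  qed
  have obj: "dual_obj N m f = (\<lambda>l. - (\<Sum>k\<in>grid N. (max 0 (shifted N m f l k))\<^sup>2) + l \<bullet> rho m f
      + (L2_set (fvec N f) (grid N))\<^sup>2)"
    by (simp add: dual_obj_def L2_set_def sum_nonneg pos_part_def fun_eq_iff)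
  have lin: "((\<lambda>l. shifted N m f l k) has_derivative (\<lambda>h. (1/2) * mom_transpose N m h k)) (at l)" for k
    unfolding shifted_def mom_transpose_def
    by (auto intro!: derivative_eq_intros bounded_linear_imp_has_derivative bounded_linear_vec_nth)
  have sq: "((\<lambda>l. (max 0 (shifted N m f l k))\<^sup>2) has_derivative
      (\<lambda>h. max 0 (shifted N m f l k) * mom_transpose N m h k)) (at l)" for k
    using has_derivative_compose[OF lin mx[unfolded has_field_derivative_def]]
    by (simp add: algebra_simps)
  have "(dual_obj N m f has_derivative
      (\<lambda>h. - (\<Sum>k\<in>grid N. max 0 (shifted N m f l k) * mom_transpose N m h k) + h \<bullet> rho m f)) (at l)"
    unfolding obj
    by (rule derivative_eq_intros has_derivative_sum has_derivative_inner_left sq refl | simp)+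
  moreover have "(\<Sum>k\<in>grid N. max 0 (shifted N m f l k) * mom_transpose N m h k)
      = h \<bullet> mom_apply N m (pos_part (shifted N m f l))" for h
    by (simp add: mom_transpose_def mom_apply_def inner_vec_def pos_part_def sum_distrib_left
        sum.swap[of _ "grid N"] mult_ac)
  ultimately show ?thesis
    by (simp add: gderiv_def dual_grad_def inner_diff_right inner_add_right)
qed

end

theory Submission
  imports Defs
begin

text \<open>
  On the range of the moment matrix the dual objective is concave, has a Lipschitz gradient and, by
  the Slater point, is coercive. The regularised Newton direction satisfies
  \<open>\<nabla>\<Phi> \<bullet> d \<ge> \<epsilon> \<parallel>d\<parallel>\<^sup>2\<close>, so backtracking stops at a step of size at least a multiple
  of \<open>\<epsilon>\<close> and each iteration gains at least a multiple of \<open>(\<epsilon> \<parallel>\<nabla>\<Phi>\<parallel>)\<^sup>2\<close>; since \<open>\<Phi>\<close> is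
  bounded above, the gradient vanishes at every accumulation point.

  For the rate, \<open>\<Phi>\<close> is piecewise quadratic: if \<open>l\<close> is close to a solution \<open>l\<^sup>*\<close>, then
  \<open>\<nabla>\<Phi>(l) = - H(l) (l - l\<^sup>*)\<close> holds exactly, whatever happens to the components of the shifted vector
  that vanish at \<open>l\<^sup>*\<close>. Hence \<open>(H(l) + \<epsilon>) (l + d - l\<^sup>*) = \<epsilon> (l - l\<^sup>*)\<close> with
  \<open>\<epsilon> = O(\<parallel>l - l\<^sup>*\<parallel>)\<close>, while the span condition makes \<open>H(l)\<close> uniformly positive definite near \<open>l\<^sup>*\<close>.
  As \<open>\<mu> < 1/2\<close>, the full step is then accepted. Strict convexity of the primal problem identifies the
  positive components of the primal minimiser with those of the shifted vector at \<open>l\<^sup>*\<close>.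
\<close>

section \<open>Auxiliary inequalities for Gram forms and the squared positive part\<close>

text \<open>The Gram operator \<open>T\<close> is injective on the span: \<open>T v = 0\<close>
  makes \<open>v\<close> orthogonal to every \<open>a k\<close>, hence to itself. Finite dimension
  then bounds \<open>norm (T v)\<close> below, and Cauchy-Schwarz transfers the bound to the
  quadratic form.\<close>

lemma sum_inner_squares_ge_on_span:
  fixes a :: "'k \<Rightarrow> 'e::euclidean_space"
  assumes "finite K"
  obtains c where "c > 0" "\<And>v. v \<in> span (a ` K) \<Longrightarrow> c * (norm v)\<^sup>2 \<le> (\<Sum>k\<in>K. (a k \<bullet> v)\<^sup>2)"
proof -
  define T where "T v = (\<Sum>k\<in>K. (a k \<bullet> v) *\<^sub>R a k)" for v
  define A where "A = (\<Sum>k\<in>K. (norm (a k))\<^sup>2)"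
  have A0: "A \<ge> 0" by (simp add: A_def sum_nonneg)
  have lin: "bounded_linear T"
    unfolding T_def by (intro bounded_linear_sum bounded_linear_scaleR_const bounded_linear_inner_right)
  have inner_T: "v \<bullet> T v = (\<Sum>k\<in>K. (a k \<bullet> v)\<^sup>2)" for v
    by (simp add: T_def inner_sum_right power2_eq_square inner_commute)
  have inj: "v = 0" if v: "v \<in> span (a ` K)" and "T v = 0" for v
  proof -
    have "(\<Sum>k\<in>K. (a k \<bullet> v)\<^sup>2) = 0" using inner_T[of v] that by simp
    hence "\<forall>k\<in>K. a k \<bullet> v = 0" using assms by (simp add: sum_nonneg_eq_0_iff)
    hence "orthogonal v w" if "w \<in> a ` K" for w using that by (auto simp: orthogonal_def inner_commute)
    hence "orthogonal v v" using orthogonal_to_span[OF v] by blast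
    thus "v = 0" by (simp add: orthogonal_self)
  qed
  obtain e where e: "e > 0" "\<forall>v\<in>span (a ` K). norm (T v) \<ge> e * norm v"
    using injective_imp_isometric[OF closed_span subspace_span lin] inj by blast
  have cs: "(norm (T v))\<^sup>2 \<le> (\<Sum>k\<in>K. (a k \<bullet> v)\<^sup>2) * A" for v
  proof -
    have "norm (T v) \<le> (\<Sum>k\<in>K. \<bar>a k \<bullet> v\<bar> * norm (a k))"
      unfolding T_def by (rule order_trans[OF norm_sum]) simp
    hence "(norm (T v))\<^sup>2 \<le> (\<Sum>k\<in>K. \<bar>a k \<bullet> v\<bar> * norm (a k))\<^sup>2" by (simp add: power_mono)
    also have "\<dots> \<le> (\<Sum>k\<in>K. \<bar>a k \<bullet> v\<bar>\<^sup>2) * A"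
      unfolding A_def by (rule Cauchy_Schwarz_ineq_sum)
    finally show ?thesis by simp
  qed
  show ?thesis
  \<comment> \<open>\<open>A + 1\<close> instead of \<open>A\<close> covers the case that all
    \<open>a k\<close> vanish.\<close>
  proof (rule that[of "e\<^sup>2 / (A + 1)"])
    show "e\<^sup>2 / (A + 1) > 0" using e A0 by simp
  next
    fix v assume "v \<in> span (a ` K)"
    hence "(e * norm v)\<^sup>2 \<le> (norm (T v))\<^sup>2" using e by (intro power_mono) auto
    also note cs
    also have "(\<Sum>k\<in>K. (a k \<bullet> v)\<^sup>2) * A \<le> (\<Sum>k\<in>K. (a k \<bullet> v)\<^sup>2) * (A + 1)"
      by (intro mult_left_mono) (auto simp: sum_nonneg)
    finally show "e\<^sup>2 / (A + 1) * (norm v)\<^sup>2 \<le> (\<Sum>k\<in>K. (a k \<bullet> v)\<^sup>2)"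
      using A0 by (simp add: field_simps power_mult_distrib)
  qed
qed

text \<open>Convexity of the squared positive part; the gap is at least
  \<open>(max 0 t - max 0 s)\<^sup>2\<close>.\<close>

lemma max0_square_ge_tangent: "(max 0 t)\<^sup>2 \<ge> (max 0 s)\<^sup>2 + 2 * max 0 s * (t - s)" for s t :: real
proof -
  have "max 0 s * t \<le> max 0 s * max 0 t" by (intro mult_left_mono) auto
  moreover have "max 0 s * s = (max 0 s)\<^sup>2" by (auto simp: max_def power2_eq_square)
  moreover have "(max 0 t - max 0 s)\<^sup>2 = (max 0 t)\<^sup>2 + (max 0 s)\<^sup>2 - 2 * (max 0 s * max 0 t)"
    by (simp add: power2_diff)
  moreover have "0 \<le> (max 0 t - max 0 s)\<^sup>2" by (rule zero_le_power2)
  ultimately show ?thesis unfolding right_diff_distrib by linarith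
qed

text \<open>The matching upper bound: the derivative \<open>2 * max 0 t\<close> is Lipschitz with
  constant 2.\<close>

lemma max0_square_le: "(max 0 t)\<^sup>2 \<le> (max 0 s)\<^sup>2 + 2 * max 0 s * (t - s) + (t - s)\<^sup>2" for s t :: real
proof (cases "s \<ge> 0")
  case True
  have "(max 0 t)\<^sup>2 \<le> t\<^sup>2" by (auto simp: max_def)
  with True show ?thesis by (simp add: max_def power2_eq_square algebra_simps)
next
  case False
  hence "max 0 t \<le> \<bar>t - s\<bar>" by auto
  hence "(max 0 t)\<^sup>2 \<le> \<bar>t - s\<bar>\<^sup>2" by (intro power_mono) auto
  with False show ?thesis by (simp add: max_def)
qed

section \<open>Piecewise quadratic dual functions\<close>

text \<open>The dual problem stripped of its Fourier origin: \<open>a k\<close> are the columns of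
  the moment matrix, \<open>b\<close> is the vector to be approximated, \<open>g\<close> holds the
  nodal values of the Slater point.\<close>

locale piecewise_quadratic_dual =
  fixes K :: "'k set" and a :: "'k \<Rightarrow> 'e::euclidean_space" and b g :: "'k \<Rightarrow> real" and \<rho> :: 'e
  assumes finite_K: "finite K"
    and g_pos: "\<And>k. k \<in> K \<Longrightarrow> g k > 0"
    and g_feasible: "(\<Sum>k\<in>K. g k *\<^sub>R a k) = \<rho>"
begin

definition R where "R = span (a ` K)"
definition s where "s l k = b k + (a k \<bullet> l) / 2"
text \<open>The constant term of the dual objective is dropped; neither the maximisers nor the line
  search see it.\<close>

definition Phi where "Phi l = - (\<Sum>k\<in>K. (max 0 (s l k))\<^sup>2) + l \<bullet> \<rho>"
definition grad where "grad l = \<rho> - (\<Sum>k\<in>K. max 0 (s l k) *\<^sub>R a k)"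

text \<open>\<open>- H l\<close> is the element of the generalised Hessian of \<open>Phi\<close> at \<open>l\<close> that the algorithm uses.\<close>

definition H where "H l v = (\<Sum>k\<in>K. (if s l k > 0 then (a k \<bullet> v) / 2 else 0) *\<^sub>R a k)"
text \<open>Half the trace of the Gram operator, which bounds every \<open>H l\<close> in norm and
  is a Lipschitz constant of \<open>grad\<close>.\<close>

definition L where "L = (\<Sum>k\<in>K. (norm (a k))\<^sup>2) / 2"

section \<open>Concavity, smoothness and coercivity of the dual function\<close>

lemma L_nonneg: "L \<ge> 0"
  by (simp add: L_def sum_nonneg)

lemma s_diff: "s y k - s x k = (a k \<bullet> (y - x)) / 2"
  by (simp add: s_def inner_diff_right field_simps)

lemma grad_inner: "grad x \<bullet> v = v \<bullet> \<rho> - (\<Sum>k\<in>K. max 0 (s x k) * (a k \<bullet> v))"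
  by (simp add: grad_def inner_diff_left inner_sum_left inner_commute[of v])

text \<open>Concavity of \<open>Phi\<close>: stationary points are global maximisers, and
  \<open>Phi\<close> is bounded above on bounded sets.\<close>

lemma Phi_le_tangent: "Phi y \<le> Phi x + grad x \<bullet> (y - x)"
proof -
  have "(\<Sum>k\<in>K. (max 0 (s x k))\<^sup>2 + max 0 (s x k) * (a k \<bullet> (y - x))) \<le> (\<Sum>k\<in>K. (max 0 (s y k))\<^sup>2)"
  proof (rule sum_mono)
    fix k
    show "(max 0 (s x k))\<^sup>2 + max 0 (s x k) * (a k \<bullet> (y - x)) \<le> (max 0 (s y k))\<^sup>2"
      using max0_square_ge_tangent[of "s x k" "s y k"] by (simp add: s_diff)
  qed
  thus ?thesis by (simp add: Phi_def grad_inner sum.distrib inner_diff_left)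
qed

text \<open>The descent-lemma bound for an \<open>L\<close>-Lipschitz gradient; it controls what a
  step can lose against the linear prediction.\<close>

lemma Phi_ge_quadratic: "Phi y \<ge> Phi x + grad x \<bullet> (y - x) - L / 2 * (norm (y - x))\<^sup>2"
proof -
  have "(max 0 (s y k))\<^sup>2 \<le> (max 0 (s x k))\<^sup>2 + max 0 (s x k) * (a k \<bullet> (y - x))
      + (norm (a k))\<^sup>2 * ((norm (y - x))\<^sup>2 / 4)" for k
  proof -
    have "\<bar>a k \<bullet> (y - x)\<bar>\<^sup>2 \<le> (norm (a k) * norm (y - x))\<^sup>2"
      by (intro power_mono Cauchy_Schwarz_ineq2) auto
    thus ?thesis using max0_square_le[of "s y k" "s x k"]
      by (simp add: s_diff power_mult_distrib power_divide)
  qed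
  hence "(\<Sum>k\<in>K. (max 0 (s y k))\<^sup>2) \<le> (\<Sum>k\<in>K. (max 0 (s x k))\<^sup>2 + max 0 (s x k) * (a k \<bullet> (y - x))
      + (norm (a k))\<^sup>2 * ((norm (y - x))\<^sup>2 / 4))"
    by (rule sum_mono)
  thus ?thesis
    unfolding sum.distrib sum_distrib_right[symmetric]
    by (simp add: Phi_def grad_inner inner_diff_left L_def)
qed

lemma H_inner: "w \<bullet> H l v = (\<Sum>k\<in>K. if s l k > 0 then (a k \<bullet> w) * (a k \<bullet> v) / 2 else 0)"
  by (auto simp: H_def inner_sum_right inner_commute[of w] intro!: sum.cong)

lemma H_add: "H l (v + w) = H l v + H l w"
  by (auto simp: H_def inner_add_right add_divide_distrib scaleR_add_left sum.distrib[symmetric] intro!: sum.cong)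

lemma H_nonneg: "v \<bullet> H l v \<ge> 0"
  by (auto simp: H_inner intro!: sum_nonneg)

lemma norm_H_le: "norm (H l v) \<le> L * norm v"
proof -
  have "norm (H l v) \<le> (\<Sum>k\<in>K. (norm (a k))\<^sup>2 * (norm v / 2))"
    unfolding H_def
  proof (rule sum_norm_le)
    fix k
    have "\<bar>a k \<bullet> v\<bar> * norm (a k) \<le> (norm (a k) * norm v) * norm (a k)"
      by (intro mult_right_mono Cauchy_Schwarz_ineq2) auto
    thus "norm ((if s l k > 0 then (a k \<bullet> v) / 2 else 0) *\<^sub>R a k) \<le> (norm (a k))\<^sup>2 * (norm v / 2)"
      by (auto simp: power2_eq_square mult_ac)
  qed
  thus ?thesis unfolding sum_distrib_right[symmetric] by (simp add: L_def)
qed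

lemma continuous_grad: "continuous_on UNIV grad"
  unfolding grad_def s_def by (intro continuous_intros) auto

text \<open>The Slater point makes \<open>l \<bullet> \<rho>\<close> the sum of
  \<open>g k * (a k \<bullet> l)\<close>. Negative terms lower \<open>Phi\<close> directly, large
  positive ones are outweighed by the squares. So every \<open>a k \<bullet> l\<close> is bounded,
  and on \<open>R\<close> this bounds \<open>l\<close>.\<close>

lemma bounded_superlevel: "bounded {l \<in> R. Phi l \<ge> c}"
proof -
  obtain c0 where c0: "c0 > 0" "\<And>v. v \<in> R \<Longrightarrow> c0 * (norm v)\<^sup>2 \<le> (\<Sum>k\<in>K. (a k \<bullet> v)\<^sup>2)"
    using sum_inner_squares_ge_on_span[OF finite_K] unfolding R_def by metis
  define C where "C = (\<Sum>k\<in>K. 4 * (g k)\<^sup>2 + 4 * g k * \<bar>b k\<bar>)"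
  define B where "B = (\<Sum>k\<in>K. ((C - c) / g k)\<^sup>2)"
  have B: "norm l \<le> sqrt (B / c0)" if l: "l \<in> R" "Phi l \<ge> c" for l
  proof -
    have "\<bar>a k \<bullet> l\<bar> * g k \<le> (4 * (g k)\<^sup>2 + 4 * g k * \<bar>b k\<bar>) - (g k * (a k \<bullet> l) - (max 0 (s l k))\<^sup>2)"
      if k: "k \<in> K" for k
    proof -
      have gp: "g k > 0" using g_pos k .
      \<comment> \<open>The tangent at \<open>2 * g k\<close> has slope \<open>2 * g k\<close> in
        \<open>a k \<bullet> l\<close>, as \<open>s\<close> carries the factor 1/2; this is twice
        the slope of the linear term.\<close>
      have "(max 0 (s l k))\<^sup>2 \<ge> (2 * g k)\<^sup>2 + 2 * (2 * g k) * (s l k - 2 * g k)"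
        using max0_square_ge_tangent[of "2 * g k" "s l k"] gp by (simp add: max_def)
      moreover have "g k * b k \<ge> - (g k * \<bar>b k\<bar>)" using gp by (simp add: abs_if)
      moreover have "(max 0 (s l k))\<^sup>2 \<ge> 0" "(g k)\<^sup>2 \<ge> 0" "g k * \<bar>b k\<bar> \<ge> 0" using gp by simp_all
      ultimately show ?thesis
        by (cases "a k \<bullet> l \<ge> 0") (simp_all add: s_def power2_eq_square algebra_simps)
    qed
    hence "(\<Sum>k\<in>K. \<bar>a k \<bullet> l\<bar> * g k) \<le>
        (\<Sum>k\<in>K. (4 * (g k)\<^sup>2 + 4 * g k * \<bar>b k\<bar>) - (g k * (a k \<bullet> l) - (max 0 (s l k))\<^sup>2))"
      by (intro sum_mono) simp
    also have "\<dots> = C - Phi l"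
    proof -
      have "l \<bullet> \<rho> = (\<Sum>k\<in>K. g k * (a k \<bullet> l))"
        by (subst g_feasible[symmetric]) (simp add: inner_sum_right inner_commute[of l])
      thus ?thesis by (simp add: C_def Phi_def sum_subtractf)
    qed
    finally have total: "(\<Sum>k\<in>K. \<bar>a k \<bullet> l\<bar> * g k) \<le> C - c" using l by simp
    have "(a k \<bullet> l)\<^sup>2 \<le> ((C - c) / g k)\<^sup>2" if k: "k \<in> K" for k
    proof -
      have "\<bar>a k \<bullet> l\<bar> * g k \<le> (\<Sum>k\<in>K. \<bar>a k \<bullet> l\<bar> * g k)"
        by (rule member_le_sum[OF k _ finite_K]) (auto simp: g_pos less_imp_le)
      hence "\<bar>a k \<bullet> l\<bar> \<le> (C - c) / g k" using total g_pos[OF k] by (simp add: field_simps)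
      hence "\<bar>a k \<bullet> l\<bar>\<^sup>2 \<le> ((C - c) / g k)\<^sup>2" by (intro power_mono) auto
      thus ?thesis by simp
    qed
    hence "(\<Sum>k\<in>K. (a k \<bullet> l)\<^sup>2) \<le> B" unfolding B_def by (rule sum_mono)
    with c0(2)[OF l(1)] have "(norm l)\<^sup>2 \<le> B / c0" using c0(1) by (simp add: field_simps)
    thus ?thesis by (simp add: real_le_rsqrt)
  qed
  show ?thesis unfolding bounded_iff using B by blast
qed

section \<open>Gain of a damped Newton step\<close>

lemma direction_inner_grad:
  assumes "H l d + \<epsilon> *\<^sub>R d = grad l"
  shows "grad l \<bullet> d \<ge> \<epsilon> * (norm d)\<^sup>2"
  using H_nonneg[of d l] unfolding assms[symmetric]
  by (simp add: inner_add_left inner_commute[of "H l d"] power2_norm_eq_inner)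

text \<open>Every step size up to \<open>t0\<close> passes the Armijo test, so backtracking cannot
  go below \<open>\<delta> * t0\<close>; with \<open>norm (grad l) \<le> (L + 1) * norm d\<close>
  this bounds the gain below. One factor \<open>L + 1\<close> comes from \<open>t0\<close>, two from
  the squared gradient bound.\<close>

lemma newton_step_ascent:
  assumes "0 \<le> \<epsilon>" "\<epsilon> \<le> 1" "0 < \<mu>" "\<mu> < 1/2" "0 < \<delta>" "\<delta> < 1"
    and dir: "H l d + \<epsilon> *\<^sub>R d = grad l"
    and armijo: "Phi (l + \<delta> ^ n *\<^sub>R d) \<ge> Phi l + \<mu> * \<delta> ^ n * (grad l \<bullet> d)"
    and minimal: "\<forall>i<n. \<not> Phi (l + \<delta> ^ i *\<^sub>R d) \<ge> Phi l + \<mu> * \<delta> ^ i * (grad l \<bullet> d)"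
  shows "Phi (l + \<delta> ^ n *\<^sub>R d) \<ge> Phi l + \<mu> * \<delta> / (L + 1) ^ 3 * (\<epsilon> * norm (grad l))\<^sup>2"
proof -
  define t0 where "t0 = \<epsilon> / (L + 1)"
  have L1: "L + 1 > 0" using L_nonneg by simp
  note gd = direction_inner_grad[OF dir]
  \<comment> \<open>For these sizes the quadratic loss eats at most half of the linear gain, and
    \<open>\<mu> < 1/2\<close> asks for no more than the other half.\<close>
  have small_step: "Phi (l + t *\<^sub>R d) \<ge> Phi l + \<mu> * t * (grad l \<bullet> d)" if t: "0 \<le> t" "t \<le> t0" for t
  proof -
    have "L * t \<le> (L + 1) * t" using t by (intro mult_right_mono) auto
    also have "\<dots> \<le> \<epsilon>" using t L1 by (simp add: t0_def field_simps)
    finally have "t * (L * t) * (norm d)\<^sup>2 \<le> t * \<epsilon> * (norm d)\<^sup>2"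
      using t by (intro mult_right_mono mult_left_mono) auto
    also have "\<dots> \<le> t * (grad l \<bullet> d)"
      using t gd by (simp add: mult.assoc mult_left_mono)
    finally have "L / 2 * (norm (t *\<^sub>R d))\<^sup>2 \<le> 1/2 * (t * (grad l \<bullet> d))"
      by (simp add: power2_eq_square mult_ac)
    moreover have "\<mu> * (t * (grad l \<bullet> d)) \<le> 1/2 * (t * (grad l \<bullet> d))"
    proof (intro mult_right_mono mult_nonneg_nonneg)
      show "grad l \<bullet> d \<ge> 0" using gd assms(1) by (meson order_trans mult_nonneg_nonneg zero_le_power2)
    qed (use assms t in auto)
    ultimately show ?thesis using Phi_ge_quadratic[of l "l + t *\<^sub>R d"] by simp
  qed
  have "t0 \<le> 1" "0 \<le> t0" using assms(1,2) L_nonneg by (auto simp: t0_def divide_le_eq)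
  \<comment> \<open>Either the full step was taken, or the last rejected size, larger by the factor
    \<open>1 / \<delta>\<close>, exceeds \<open>t0\<close>.\<close>
  have step: "\<delta> ^ n \<ge> \<delta> * t0"
  proof (cases n)
    case 0
    have "\<delta> * t0 \<le> 1 * 1" using assms \<open>t0 \<le> 1\<close> \<open>0 \<le> t0\<close> by (intro mult_mono) auto
    with 0 show ?thesis by simp
  next
    case (Suc i)
    hence "\<not> \<delta> ^ i \<le> t0" using small_step[of "\<delta> ^ i"] minimal assms by auto
    with Suc show ?thesis using assms by simp
  qed
  have "norm (grad l) \<le> norm (H l d) + norm (\<epsilon> *\<^sub>R d)"
    unfolding dir[symmetric] by (rule norm_triangle_ineq)
  also have "\<dots> \<le> L * norm d + 1 * norm d"
    using norm_H_le[of l d] assms(1,2) unfolding norm_scaleR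
    by (intro add_mono mult_right_mono) auto
  finally have "norm (grad l) / (L + 1) \<le> norm d" using L1 by (simp add: field_simps)
  hence "(norm (grad l) / (L + 1))\<^sup>2 \<le> (norm d)\<^sup>2" using L1 by (intro power_mono) auto
  hence "\<epsilon> * (norm (grad l) / (L + 1))\<^sup>2 \<le> grad l \<bullet> d"
    using gd assms(1) by (meson mult_left_mono order_trans)
  hence "(\<mu> * (\<delta> * t0)) * (\<epsilon> * (norm (grad l) / (L + 1))\<^sup>2) \<le> (\<mu> * \<delta> ^ n) * (grad l \<bullet> d)"
    using step assms \<open>0 \<le> t0\<close> by (intro mult_mono mult_left_mono) auto
  also have "(\<mu> * (\<delta> * t0)) * (\<epsilon> * (norm (grad l) / (L + 1))\<^sup>2)
      = \<mu> * \<delta> / (L + 1) ^ 3 * (\<epsilon> * norm (grad l))\<^sup>2"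
    unfolding t0_def by (simp add: power_divide power_mult_distrib power2_eq_square[of \<epsilon>]
        power2_eq_square[of "L + 1"] power3_eq_cube mult.assoc)
  finally show ?thesis using armijo by linarith
qed

section \<open>Exact quadratic model near a stationary point\<close>

text \<open>Continuity preserves strict signs only; components that vanish at \<open>ls\<close> may
  take either sign nearby.\<close>

lemma eventually_sign_stable:
  "\<forall>\<^sub>F l in nhds ls. \<forall>k\<in>K. (s ls k > 0 \<longrightarrow> s l k > 0) \<and> (s ls k < 0 \<longrightarrow> s l k < 0)"
proof (rule eventually_ball_finite[OF finite_K], rule ballI)
  fix k
  have lim: "((\<lambda>l. s l k) \<longlongrightarrow> s ls k) (nhds ls)"
    unfolding s_def by (intro tendsto_intros) (auto simp: filterlim_ident)
  have "s ls k > 0 \<longrightarrow> (\<forall>\<^sub>F l in nhds ls. s l k > 0)" "s ls k < 0 \<longrightarrow> (\<forall>\<^sub>F l in nhds ls. s l k < 0)"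
    using order_tendstoD[OF lim] by auto
  thus "\<forall>\<^sub>F l in nhds ls. (s ls k > 0 \<longrightarrow> s l k > 0) \<and> (s ls k < 0 \<longrightarrow> s l k < 0)"
    by (intro eventually_conj) (cases "s ls k > 0"; cases "s ls k < 0"; simp)+
qed

context
  fixes ls l :: 'e
  assumes stationary: "grad ls = 0"
    and stable: "\<forall>k\<in>K. (s ls k > 0 \<longrightarrow> s l k > 0) \<and> (s ls k < 0 \<longrightarrow> s l k < 0)"
begin

text \<open>If \<open>s l k > 0\<close> then \<open>s ls k \<ge> 0\<close>, otherwise
  \<open>s ls k \<le> 0\<close>, so each positive part changes by the full increment of
  \<open>s\<close> or not at all. Components vanishing at \<open>ls\<close> fit both cases, hence
  there is no remainder.\<close>

lemma grad_near_stationary: "grad l = - H l (l - ls)"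
proof -
  have "max 0 (s l k) - max 0 (s ls k) = (if s l k > 0 then (a k \<bullet> (l - ls)) / 2 else 0)" if "k \<in> K" for k
    using stable that by (auto simp: max_def s_diff[symmetric] not_less dest: bspec)
  hence "H l (l - ls) = (\<Sum>k\<in>K. (max 0 (s l k) - max 0 (s ls k)) *\<^sub>R a k)"
    unfolding H_def by (intro sum.cong) auto
  also have "\<dots> = grad ls - grad l" by (simp add: grad_def scaleR_diff_left sum_subtractf)
  finally show ?thesis using stationary by simp
qed

text \<open>Stationarity supplies the linear term that completes the square in every component with
  \<open>s l k > 0\<close>.\<close>

lemma Phi_near_stationary: "Phi l = Phi ls - (l - ls) \<bullet> H l (l - ls) / 2"
proof -
  have "(max 0 (s ls k))\<^sup>2 - (max 0 (s l k))\<^sup>2 + max 0 (s ls k) * (a k \<bullet> (l - ls))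
      = - (if s l k > 0 then (a k \<bullet> (l - ls)) * (a k \<bullet> (l - ls)) / 2 else 0) / 2" if k: "k \<in> K" for k
  proof -
    have ak: "a k \<bullet> (l - ls) = 2 * (s l k - s ls k)" by (simp add: s_diff)
    show ?thesis
    proof (cases "s l k > 0")
      case True
      hence "s ls k \<ge> 0" using stable k by force
      with True show ?thesis unfolding ak by (simp add: power2_eq_square field_simps)
    next
      case False
      hence "s ls k \<le> 0" using stable k by force
      with False show ?thesis by (simp add: max_def)
    qed
  qed
  hence "(\<Sum>k\<in>K. (max 0 (s ls k))\<^sup>2 - (max 0 (s l k))\<^sup>2 + max 0 (s ls k) * (a k \<bullet> (l - ls)))
      = - ((l - ls) \<bullet> H l (l - ls)) / 2"
    unfolding H_inner by (simp add: sum_negf sum_divide_distrib)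
  moreover have "(l - ls) \<bullet> \<rho> = (\<Sum>k\<in>K. max 0 (s ls k) * (a k \<bullet> (l - ls)))"
    using grad_inner[of ls "l - ls"] stationary by simp
  ultimately show ?thesis
    using inner_diff_left[of l ls \<rho>] unfolding Phi_def sum.distrib sum_subtractf by linarith
qed

end

text \<open>The conclusions are uniform on a ball: quadratic error reduction and the Armijo test
  with exponent 0. The bound on \<open>C * r\<close> turns the former into contraction by one
  half.\<close>

lemma local_full_step:
  assumes stationary: "grad ls = 0" and "0 \<le> \<tau>" "\<mu> < 1/2" "0 < \<mu>"
    and lsR: "ls \<in> R" and spanning: "span (a ` {k \<in> K. s ls k > 0}) = R"
  obtains r C where "r > 0" "C \<ge> 0" "C * r \<le> 1/2"
    "\<And>l d \<epsilon>. \<lbrakk>l \<in> R; d \<in> R; norm (l - ls) < r; 0 \<le> \<epsilon>; \<epsilon> \<le> \<tau> * norm (grad l);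
      H l d + \<epsilon> *\<^sub>R d = grad l\<rbrakk> \<Longrightarrow>
      norm (l + d - ls) \<le> C * (norm (l - ls))\<^sup>2 \<and> Phi (l + d) \<ge> Phi l + \<mu> * (grad l \<bullet> d)"
proof -
  obtain c where c: "c > 0" "\<And>v. v \<in> R \<Longrightarrow> c * (norm v)\<^sup>2 \<le> (\<Sum>k\<in>{k \<in> K. s ls k > 0}. (a k \<bullet> v)\<^sup>2)"
    using sum_inner_squares_ge_on_span[of "{k \<in> K. s ls k > 0}" a] finite_K unfolding spanning by auto
  obtain r0 where r0: "r0 > 0" "\<And>l. norm (l - ls) < r0 \<Longrightarrow>
      \<forall>k\<in>K. (s ls k > 0 \<longrightarrow> s l k > 0) \<and> (s ls k < 0 \<longrightarrow> s l k < 0)"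
    using eventually_sign_stable[of ls] unfolding eventually_nhds_metric dist_norm by blast
  define c1 where "c1 = c / 2"
  have c1: "c1 > 0" using c by (simp add: c1_def)
  \<comment> \<open>Indices active at \<open>ls\<close> stay active at \<open>l\<close>; further
    ones add nonnegative terms.\<close>
  have posdef: "c1 * (norm v)\<^sup>2 \<le> v \<bullet> H l v" if v: "v \<in> R" and l: "norm (l - ls) < r0" for v l
  proof -
    have "c1 * (norm v)\<^sup>2 \<le> (\<Sum>k\<in>{k \<in> K. s ls k > 0}. (a k \<bullet> v)\<^sup>2) / 2" using c(2)[OF v] by (simp add: c1_def)
    also have "\<dots> = (\<Sum>k\<in>K. if s ls k > 0 then (a k \<bullet> v)\<^sup>2 / 2 else 0)"
      unfolding sum_divide_distrib using finite_K by (rule sum.inter_filter)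
    also have "\<dots> \<le> v \<bullet> H l v"
      unfolding H_inner using r0(2)[OF l] by (intro sum_mono) (auto simp: power2_eq_square)
    finally show ?thesis .
  qed
  \<comment> \<open>\<open>C\<close> comes from \<open>\<epsilon> \<le> \<tau> * L * norm e\<close>
    divided by the curvature \<open>c1\<close>; \<open>D\<close> collects the cubic errors in the
    Armijo test. The bounds in \<open>r\<close> give \<open>norm e \<le> 1\<close>, keep
    \<open>l\<close> and \<open>l + d\<close> sign-stable, ensure contraction, and let the curvature
    margin absorb \<open>D\<close>.\<close>
  define C where "C = \<tau> * L / c1"
  define D where "D = \<mu> * L * C + L * C\<^sup>2"
  define r where "r = min (min 1 (r0 / (C + 1))) (min (1 / (2 * (C + 1))) (c1 * (1/2 - \<mu>) / (D + 1)))"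
  have C0: "C \<ge> 0" using assms c1 L_nonneg by (simp add: C_def)
  have D0: "D \<ge> 0" using C0 assms L_nonneg by (simp add: D_def)
  have "r \<le> 1" "r \<le> r0 / (C + 1)" "r \<le> 1 / (2 * (C + 1))" "r \<le> c1 * (1/2 - \<mu>) / (D + 1)"
    by (auto simp: r_def)
  moreover have "C + 1 > 0" "D + 1 > 0" using C0 D0 by simp_all
  ultimately have r: "r \<le> 1" "(C + 1) * r \<le> r0" "(C + 1) * r \<le> 1/2" "(D + 1) * r \<le> c1 * (1/2 - \<mu>)"
    by (simp_all add: pos_le_divide_eq mult_ac)
  have r_pos: "r > 0"
    unfolding r_def using \<open>C + 1 > 0\<close> \<open>D + 1 > 0\<close> r0(1) c1 assms(3) by simp
  show ?thesis
  proof (rule that[of r C])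
    show "r > 0" "C \<ge> 0" by fact+
    show "C * r \<le> 1/2" using r(3) r_pos by (simp add: algebra_simps)
  next
    fix l d \<epsilon>
    assume asm: "l \<in> R" "d \<in> R" "norm (l - ls) < r" "0 \<le> \<epsilon>" "\<epsilon> \<le> \<tau> * norm (grad l)"
      and dir: "H l d + \<epsilon> *\<^sub>R d = grad l"
    define e where "e = l - ls"
    define e' where "e' = l + d - ls"
    have ed: "d = e' - e" "e' = e + d" by (simp_all add: e_def e'_def)
    have eR: "e \<in> R" "e' \<in> R"
      using asm lsR by (auto simp: e_def e'_def R_def span_diff span_add)
    have "C * r \<ge> 0" using C0 r_pos by simp
    hence "r \<le> r0" using r(2) by (simp add: algebra_simps)
    hence near: "norm (l - ls) < r0" using asm by simp
    note stable = r0(2)[OF near]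
    have gl: "grad l = - H l e" unfolding e_def by (rule grad_near_stationary[OF stationary stable])
    \<comment> \<open>The Newton step cancels the exact model; only the regularisation
      remains.\<close>
    have eq: "H l e' + \<epsilon> *\<^sub>R e' = \<epsilon> *\<^sub>R e"
    proof -
      have "H l e + (H l d + \<epsilon> *\<^sub>R d) = 0" unfolding dir gl by simp
      thus ?thesis unfolding ed(2) H_add scaleR_add_right by (simp add: add_ac)
    qed
    have \<epsilon>: "\<epsilon> \<le> \<tau> * L * norm e"
      using asm(5) norm_H_le[of l e] assms(2) unfolding gl
      by (smt (verit) mult.assoc mult_left_mono norm_minus_cancel)
    have "c1 * (norm e')\<^sup>2 \<le> e' \<bullet> H l e'" using posdef[OF eR(2) near] .
    also have "\<dots> \<le> e' \<bullet> (H l e' + \<epsilon> *\<^sub>R e')" using asm by (simp add: inner_add_right)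
    also have "\<dots> = \<epsilon> * (e' \<bullet> e)" by (simp add: eq)
    also have "\<dots> \<le> \<epsilon> * (norm e' * norm e)" using asm by (intro mult_left_mono norm_cauchy_schwarz) auto
    also have "\<dots> \<le> (\<tau> * L * norm e) * (norm e' * norm e)" using \<epsilon> by (intro mult_right_mono) auto
    finally have "norm e' * (c1 * norm e') \<le> norm e' * (\<tau> * L * (norm e)\<^sup>2)"
      by (simp add: power2_eq_square mult_ac)
    hence "c1 * norm e' \<le> \<tau> * L * (norm e)\<^sup>2"
      using assms(2) L_nonneg by (cases "norm e' = 0") (auto simp: mult_le_cancel_left)
    hence quad: "norm e' \<le> C * (norm e)\<^sup>2" using c1 by (simp add: C_def field_simps)
    have er: "norm e < r" using asm by (simp add: e_def)
    \<comment> \<open>The model is needed at \<open>l + d\<close> too, so this point must lie in the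
      sign-stable ball.\<close>
    have "C * (norm e)\<^sup>2 \<le> C * (r * r)"
      unfolding power2_eq_square using er r_pos C0 by (intro mult_left_mono mult_mono) auto
    also have "\<dots> \<le> C * r" using r(1) r_pos C0 by (simp add: mult_left_le mult_left_mono)
    also have "\<dots> < r0" using r(2) r_pos by (simp add: algebra_simps)
    finally have near': "norm (l + d - ls) < r0" using quad by (simp add: e'_def)
    note stable' = r0(2)[OF near']
    have P: "Phi l = Phi ls - e \<bullet> H l e / 2"
      unfolding e_def by (rule Phi_near_stationary[OF stationary stable])
    have P': "Phi (l + d) = Phi ls - e' \<bullet> H (l + d) e' / 2"
      unfolding e'_def by (rule Phi_near_stationary[OF stationary stable'])
    have "e' \<bullet> H (l + d) e' \<le> norm e' * (L * norm e')"
      by (rule order_trans[OF norm_cauchy_schwarz]) (simp add: mult_left_mono norm_H_le)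
    also have "\<dots> = L * (norm e')\<^sup>2" by (simp add: power2_eq_square)
    also have "\<dots> \<le> L * (C * (norm e)\<^sup>2)\<^sup>2"
      using quad L_nonneg by (intro mult_left_mono power_mono) auto
    also have "\<dots> = L * C\<^sup>2 * (norm e) ^ 4" by (simp add: power_mult_distrib flip: power_mult)
    also have "\<dots> \<le> L * C\<^sup>2 * (norm e) ^ 3"
      using er r L_nonneg by (intro mult_left_mono power_decreasing) auto
    finally have b1: "e' \<bullet> H (l + d) e' \<le> L * C\<^sup>2 * (norm e) ^ 3" .
    have "\<bar>e' \<bullet> H l e\<bar> \<le> norm e' * (L * norm e)"
      by (rule order_trans[OF Cauchy_Schwarz_ineq2]) (simp add: mult_left_mono norm_H_le)
    also have "\<dots> \<le> (C * (norm e)\<^sup>2) * (L * norm e)"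
      using quad L_nonneg by (intro mult_right_mono) auto
    also have "\<dots> = L * C * (norm e) ^ 3" by (simp add: power2_eq_square power3_eq_cube)
    finally have "- (L * C * (norm e) ^ 3) \<le> e' \<bullet> H l e" by linarith
    hence "\<mu> * - (L * C * (norm e) ^ 3) \<le> \<mu> * (e' \<bullet> H l e)"
      using assms(4) by (intro mult_left_mono) auto
    hence b2: "\<mu> * (e' \<bullet> H l e) \<ge> - (\<mu> * L * C * (norm e) ^ 3)" by (simp add: mult.assoc)
    have "D * norm e \<le> (D + 1) * r" using er D0 by (intro mult_mono) auto
    also note r(4)
    finally have "(D * norm e) * (norm e)\<^sup>2 \<le> (c1 * (1/2 - \<mu>)) * (norm e)\<^sup>2"
      by (intro mult_right_mono) auto
    also have "\<dots> \<le> (1/2 - \<mu>) * (e \<bullet> H l e)"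
      using posdef[OF eR(1) near] assms(3) by (simp add: mult_ac mult_left_mono)
    finally have b3: "D * (norm e) ^ 3 \<le> (1/2 - \<mu>) * (e \<bullet> H l e)"
      by (simp add: power2_eq_square power3_eq_cube mult_ac)
    \<comment> \<open>The model gives the gain
      \<open>(e \<bullet> H l e - e' \<bullet> H (l + d) e') / 2\<close>, while the test asks for
      \<open>\<mu> * (grad l \<bullet> d)\<close>. The surplus is
      \<open>(1/2 - \<mu>) * (e \<bullet> H l e)\<close> up to cubic terms.\<close>
    have gd: "grad l \<bullet> d = e \<bullet> H l e - e' \<bullet> H l e"
      unfolding gl ed(1) by (simp add: inner_diff_left inner_commute[of "H l e"])
    have "L * C\<^sup>2 * (norm e) ^ 3 / 2 \<le> L * C\<^sup>2 * (norm e) ^ 3" using L_nonneg by simp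
    moreover have "D * (norm e) ^ 3 = \<mu> * L * C * (norm e) ^ 3 + L * C\<^sup>2 * (norm e) ^ 3"
      by (simp add: D_def algebra_simps)
    ultimately have "Phi (l + d) \<ge> Phi l + \<mu> * (grad l \<bullet> d)"
      using b1 b2 b3 unfolding P P' gd left_diff_distrib right_diff_distrib by linarith
    with quad show "norm (l + d - ls) \<le> C * (norm (l - ls))\<^sup>2 \<and> Phi (l + d) \<ge> Phi l + \<mu> * (grad l \<bullet> d)"
      by (simp add: e_def e'_def)
  qed
qed

text \<open>The difference between \<open>h\<close> and the positive part of \<open>s ls\<close> is
  killed by the moment map, so its pairing with \<open>ls\<close> vanishes. The variational
  inequality of the projection onto the orthant leaves a Pythagorean estimate, and
  \<open>opt\<close> forces the difference to be zero.\<close>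

lemma stationary_imp_primal_unique:
  assumes "grad ls = 0" and nonneg: "\<And>k. k \<in> K \<Longrightarrow> h k \<ge> 0" and feasible: "(\<Sum>k\<in>K. h k *\<^sub>R a k) = \<rho>"
    and opt: "(\<Sum>k\<in>K. (h k - b k)\<^sup>2) \<le> (\<Sum>k\<in>K. (max 0 (s ls k) - b k)\<^sup>2)" and "k \<in> K"
  shows "h k = max 0 (s ls k)"
proof -
  let ?p = "\<lambda>k. max 0 (s ls k)"
  have "(\<Sum>k\<in>K. (h k - ?p k) *\<^sub>R a k) = 0"
    using assms(1) feasible by (simp add: grad_def scaleR_diff_left sum_subtractf)
  hence "(\<Sum>k\<in>K. (h k - ?p k) *\<^sub>R a k) \<bullet> ls = 0" by simp
  hence orth: "(\<Sum>k\<in>K. (h k - ?p k) * (a k \<bullet> ls)) = 0" by (simp add: inner_sum_left)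
  have "(h k - ?p k)\<^sup>2 + (?p k - b k)\<^sup>2 + (h k - ?p k) * (a k \<bullet> ls) \<le> (h k - b k)\<^sup>2" if "k \<in> K" for k
  proof -
    have "(h k - ?p k) * (?p k - s ls k) \<ge> 0"
      using nonneg[OF that] by (auto simp: max_def mult_nonneg_nonpos)
    moreover have "(h k - b k)\<^sup>2 = (h k - ?p k)\<^sup>2 + (?p k - b k)\<^sup>2 + (h k - ?p k) * (a k \<bullet> ls)
        + 2 * ((h k - ?p k) * (?p k - s ls k))"
      by (simp add: s_def power2_eq_square field_simps)
    ultimately show ?thesis by simp
  qed
  hence "(\<Sum>k\<in>K. (h k - ?p k)\<^sup>2 + (?p k - b k)\<^sup>2 + (h k - ?p k) * (a k \<bullet> ls)) \<le> (\<Sum>k\<in>K. (h k - b k)\<^sup>2)"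
    by (rule sum_mono)
  with opt orth have "(\<Sum>k\<in>K. (h k - ?p k)\<^sup>2) \<le> 0" by (simp add: sum.distrib)
  hence "(\<Sum>k\<in>K. (h k - ?p k)\<^sup>2) = 0" by (simp add: order_antisym sum_nonneg)
  thus ?thesis using finite_K \<open>k \<in> K\<close> by (simp add: sum_nonneg_eq_0_iff)
qed

end

section \<open>The damped Newton iteration\<close>

text \<open>The algorithm asserts that a direction and an exponent exist in each iteration; here
  they are fixed as sequences. The Newton system appears with both sides negated.\<close>

locale newton_iteration = piecewise_quadratic_dual K a b g \<rho>
  for K :: "'k set" and a :: "'k \<Rightarrow> 'e::euclidean_space" and b g :: "'k \<Rightarrow> real" and \<rho> :: 'e +
  fixes \<tau>\<^sub>1 \<tau>\<^sub>2 \<mu> \<delta> :: real and lam dir :: "nat \<Rightarrow> 'e" and n :: "nat \<Rightarrow> nat"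
  assumes parameters: "0 < \<tau>\<^sub>1" "\<tau>\<^sub>1 < 1" "0 < \<tau>\<^sub>2" "\<tau>\<^sub>2 < 1" "0 < \<mu>" "\<mu> < 1/2" "0 < \<delta>" "\<delta> < 1"
    and lam_0: "lam 0 = 0"
    and dir_R: "\<And>j. dir j \<in> R"
    and dir_eq: "\<And>j. H (lam j) (dir j) + (\<tau>\<^sub>1 * min \<tau>\<^sub>2 (norm (grad (lam j)))) *\<^sub>R dir j = grad (lam j)"
    and armijo_n: "\<And>j. Phi (lam j + \<delta> ^ n j *\<^sub>R dir j) \<ge> Phi (lam j) + \<mu> * \<delta> ^ n j * (grad (lam j) \<bullet> dir j)"
    and minimal_n: "\<And>j. \<forall>i<n j.
      \<not> Phi (lam j + \<delta> ^ i *\<^sub>R dir j) \<ge> Phi (lam j) + \<mu> * \<delta> ^ i * (grad (lam j) \<bullet> dir j)"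
    and lam_Suc: "\<And>j. lam (Suc j) = lam j + \<delta> ^ n j *\<^sub>R dir j"
begin

section \<open>Boundedness, stationary accumulation points and the local rate\<close>

abbreviation eps where "eps j \<equiv> \<tau>\<^sub>1 * min \<tau>\<^sub>2 (norm (grad (lam j)))"

lemma eps_bounds: "0 \<le> eps j" "eps j \<le> 1" "eps j \<le> \<tau>\<^sub>1 * norm (grad (lam j))"
  using parameters by (auto intro!: mult_le_one)

lemma lam_R: "lam j \<in> R"
  by (induction j) (use dir_R in \<open>auto simp: lam_0 lam_Suc R_def intro!: span_add span_scale span_0\<close>)

lemma ascent: "Phi (lam (Suc j)) \<ge> Phi (lam j) + \<mu> * \<delta> / (L + 1) ^ 3 * (eps j * norm (grad (lam j)))\<^sup>2"
  unfolding lam_Suc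
  by (rule newton_step_ascent[OF eps_bounds(1,2) parameters(5-8) dir_eq armijo_n minimal_n])

lemma incseq_Phi: "incseq (\<lambda>j. Phi (lam j))"
proof (rule incseq_SucI)
  fix j
  have "\<mu> * \<delta> / (L + 1) ^ 3 * (eps j * norm (grad (lam j)))\<^sup>2 \<ge> 0"
    using parameters L_nonneg by simp
  thus "Phi (lam j) \<le> Phi (lam (Suc j))" using ascent[of j] by linarith
qed

lemma bounded_lam: "bounded (range lam)"
proof (rule bounded_subset[OF bounded_superlevel[of "Phi (lam 0)"]])
  show "range lam \<subseteq> {l \<in> R. Phi (lam 0) \<le> Phi l}"
    using lam_R incseqD[OF incseq_Phi, of 0] by auto
qed

text \<open>Concavity bounds \<open>Phi\<close> above along the bounded iterates, so its increasing
  values converge; up to a constant, their increments dominate the squares of these terms.\<close>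

lemma eps_grad_tendsto_0: "(\<lambda>j. eps j * norm (grad (lam j))) \<longlonglongrightarrow> 0"
proof -
  define c where "c = \<mu> * \<delta> / (L + 1) ^ 3"
  have c: "c > 0" using parameters L_nonneg by (simp add: c_def)
  obtain B where B: "\<And>j. norm (lam j) \<le> B" using bounded_lam by (auto simp: bounded_iff)
  have "Phi (lam j) \<le> Phi 0 + norm (grad 0) * B" for j
  proof -
    have "Phi (lam j) \<le> Phi 0 + grad 0 \<bullet> lam j" using Phi_le_tangent[of "lam j" 0] by simp
    also have "grad 0 \<bullet> lam j \<le> norm (grad 0) * norm (lam j)" by (rule norm_cauchy_schwarz)
    also have "\<dots> \<le> norm (grad 0) * B" by (intro mult_left_mono B) simp
    finally show ?thesis by simp
  qed
  then obtain P where P: "(\<lambda>j. Phi (lam j)) \<longlonglongrightarrow> P"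
    using incseq_convergent[OF incseq_Phi] by metis
  have lim: "(\<lambda>j. (Phi (lam (Suc j)) - Phi (lam j)) / c) \<longlonglongrightarrow> 0"
    using tendsto_divide[OF tendsto_diff[OF LIMSEQ_Suc[OF P] P] tendsto_const[of c]] c by simp
  have "(\<lambda>j. (eps j * norm (grad (lam j)))\<^sup>2) \<longlonglongrightarrow> 0"
  proof (rule tendsto_sandwich[OF _ _ tendsto_const lim])
    show "\<forall>\<^sub>F j in sequentially. (eps j * norm (grad (lam j)))\<^sup>2 \<le> (Phi (lam (Suc j)) - Phi (lam j)) / c"
    proof (intro always_eventually allI)
      fix j
      show "(eps j * norm (grad (lam j)))\<^sup>2 \<le> (Phi (lam (Suc j)) - Phi (lam j)) / c"
        using ascent[of j, folded c_def] unfolding pos_le_divide_eq[OF c] mult.commute[of _ c] by linarith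
    qed
  qed auto
  thus ?thesis by simp
qed

text \<open>The regularisation depends continuously on the gradient, so its product with the
  gradient norm passes to the limit and must vanish there. Membership in \<open>R\<close> holds as
  subspaces are closed.\<close>

lemma accumulation_point_stationary:
  assumes "accumulation_point lam l"
  shows "l \<in> R" "grad l = 0"
proof -
  obtain r where r: "strict_mono r" "(lam \<circ> r) \<longlonglongrightarrow> l"
    using assms by (auto simp: accumulation_point_def)
  show "l \<in> R"
    using r(2) by (rule closed_sequentially[OF closed_span[of "a ` K", folded R_def], rotated])
      (simp add: lam_R)
  have "isCont grad l" using continuous_grad by (simp add: continuous_on_eq_continuous_at)
  from isCont_tendsto_compose[OF this r(2)]
  have "(\<lambda>j. \<tau>\<^sub>1 * min \<tau>\<^sub>2 (norm (grad (lam (r j)))) * norm (grad (lam (r j))))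
      \<longlonglongrightarrow> \<tau>\<^sub>1 * min \<tau>\<^sub>2 (norm (grad l)) * norm (grad l)"
    by (intro tendsto_intros) (auto simp: o_def)
  moreover have "(\<lambda>j. eps (r j) * norm (grad (lam (r j)))) \<longlonglongrightarrow> 0"
    using LIMSEQ_subseq_LIMSEQ[OF eps_grad_tendsto_0 r(1)] by (simp add: o_def)
  ultimately have "\<tau>\<^sub>1 * min \<tau>\<^sub>2 (norm (grad l)) * norm (grad l) = 0" by (rule LIMSEQ_unique)
  thus "grad l = 0" using parameters by (auto simp: min_def split: if_splits)
qed

lemma ex_accumulation_point: "\<exists>l. accumulation_point lam l"
  using bounded_imp_convergent_subsequence[OF bounded_lam] unfolding accumulation_point_def by blast

text \<open>Some iterate enters the ball of the local estimate. From there on the error at least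
  halves, so the iterates never leave the ball and the whole sequence converges.\<close>

lemma quadratic_convergence:
  assumes acc: "accumulation_point lam ls" and spanning: "span (a ` {k \<in> K. s ls k > 0}) = R"
  shows "lam \<longlonglongrightarrow> ls"
    and "\<exists>C. \<forall>\<^sub>F j in sequentially. norm (lam (Suc j) - ls) \<le> C * (norm (lam j - ls))\<^sup>2"
proof -
  note stat = accumulation_point_stationary[OF acc]
  have "0 \<le> \<tau>\<^sub>1" using parameters by simp
  obtain r C where rC: "r > 0" "C \<ge> 0" "C * r \<le> 1/2"
    and step: "\<And>l d \<epsilon>. \<lbrakk>l \<in> R; d \<in> R; norm (l - ls) < r; 0 \<le> \<epsilon>; \<epsilon> \<le> \<tau>\<^sub>1 * norm (grad l);
      H l d + \<epsilon> *\<^sub>R d = grad l\<rbrakk> \<Longrightarrow>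
      norm (l + d - ls) \<le> C * (norm (l - ls))\<^sup>2 \<and> Phi (l + d) \<ge> Phi l + \<mu> * (grad l \<bullet> d)"
    using local_full_step[OF stat(2) \<open>0 \<le> \<tau>\<^sub>1\<close> parameters(6,5) stat(1) spanning] by metis
  have quad: "norm (lam (Suc j) - ls) \<le> C * (norm (lam j - ls))\<^sup>2" if "norm (lam j - ls) < r" for j
  proof -
    note st = step[OF lam_R dir_R that eps_bounds(1,3) dir_eq]
    \<comment> \<open>Exponent 0 already passes the test, so the minimal exponent is 0 and the full
      step is taken.\<close>
    have "n j = 0" using minimal_n[of j] st by auto
    thus ?thesis using st by (simp add: lam_Suc)
  qed
  have half: "norm (lam (Suc j) - ls) \<le> norm (lam j - ls) / 2" if j: "norm (lam j - ls) < r" for j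
  proof -
    have "C * norm (lam j - ls) \<le> 1/2" using rC j by (smt (verit) mult_left_mono)
    hence "(C * norm (lam j - ls)) * norm (lam j - ls) \<le> 1/2 * norm (lam j - ls)"
      by (intro mult_right_mono) auto
    thus ?thesis using quad[OF j] by (simp add: power2_eq_square mult.assoc)
  qed
  obtain q where q: "strict_mono q" "(lam \<circ> q) \<longlonglongrightarrow> ls"
    using acc by (auto simp: accumulation_point_def)
  obtain i where "norm ((lam \<circ> q) i - ls) < r"
    using LIMSEQ_D[OF q(2) rC(1)] by blast
  then obtain j0 where j0: "norm (lam j0 - ls) < r" by auto
  have geo: "norm (lam (i + j0) - ls) < r \<and> norm (lam (i + j0) - ls) \<le> r * (1/2) ^ i" for i
  proof (induction i)
    case (Suc i)
    hence "norm (lam (Suc (i + j0)) - ls) \<le> norm (lam (i + j0) - ls) / 2" by (intro half) simp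
    moreover have "norm (lam (i + j0) - ls) / 2 \<le> norm (lam (i + j0) - ls)" by simp
    ultimately show ?case using Suc unfolding add_Suc power_Suc by linarith
  qed (use j0 in simp)
  have "(\<lambda>i. r * (1/2) ^ i) \<longlonglongrightarrow> 0"
    by (intro tendsto_mult_right_zero LIMSEQ_power_zero) simp
  hence "(\<lambda>i. lam (i + j0) - ls) \<longlonglongrightarrow> 0"
    by (rule Lim_null_comparison[rotated]) (use geo in auto)
  thus "lam \<longlonglongrightarrow> ls" by (simp add: LIM_zero_iff LIMSEQ_offset)
  have "\<forall>\<^sub>F j in sequentially. norm (lam (Suc j) - ls) \<le> C * (norm (lam j - ls))\<^sup>2"
    using geo quad by (intro eventually_sequentiallyI[of j0]) (metis le_add_diff_inverse2)
  thus "\<exists>C. \<forall>\<^sub>F j in sequentially. norm (lam (Suc j) - ls) \<le> C * (norm (lam j - ls))\<^sup>2" ..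
qed

end

section \<open>The moment matrix\<close>

lemma mom_apply_eq_sum: "mom_apply N m g = (\<Sum>k\<in>grid N. g k *\<^sub>R mom_col N m k)"
  by (simp add: mom_apply_def mom_col_def vec_eq_iff mult.commute)

lemma mom_transpose_eq_inner: "mom_transpose N m l k = mom_col N m k \<bullet> l"
  by (simp add: mom_transpose_def mom_col_def inner_vec_def)

lemma Ran_eq_span: "Ran N m = span (mom_col N m ` grid N)"
proof
  show "Ran N m \<subseteq> span (mom_col N m ` grid N)"
    unfolding Ran_def mom_apply_eq_sum by (blast intro: span_sum span_scale span_base)
  have "mom_col N m k \<in> Ran N m" if "k \<in> grid N" for k
  proof -
    have "mom_col N m k = mom_apply N m (\<lambda>i. if i = k then 1 else 0)"
      using that by (simp add: mom_apply_eq_sum if_distrib[of "\<lambda>c. c *\<^sub>R _"] finite_grid cong: if_cong)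
    thus ?thesis by (auto simp: Ran_def)
  qed
  moreover have "subspace (Ran N m)"
    unfolding subspace_def
  proof safe
    have "mom_apply N m (\<lambda>_. 0) = 0" by (simp add: mom_apply_eq_sum)
    thus "0 \<in> Ran N m" unfolding Ran_def by (metis rangeI)
  next
    fix x y assume "x \<in> Ran N m" "y \<in> Ran N m"
    then obtain g h where "x = mom_apply N m g" "y = mom_apply N m h" by (auto simp: Ran_def)
    hence "x + y = mom_apply N m (\<lambda>k. g k + h k)"
      by (simp add: mom_apply_eq_sum scaleR_add_left sum.distrib)
    thus "x + y \<in> Ran N m" by (simp add: Ran_def)
  next
    fix c x assume "x \<in> Ran N m"
    then obtain g where "x = mom_apply N m g" by (auto simp: Ran_def)
    hence "c *\<^sub>R x = mom_apply N m (\<lambda>k. c * g k)"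
      by (simp add: mom_apply_eq_sum scaleR_sum_right)
    thus "c *\<^sub>R x \<in> Ran N m" by (simp add: Ran_def)
  qed
  ultimately show "span (mom_col N m ` grid N) \<subseteq> Ran N m"
    by (intro span_minimal) auto
qed

lemma newton_mat_mult_vec:
  "newton_mat N m u \<epsilon> *v d = - (\<Sum>k\<in>grid N. (u k * (mom_col N m k \<bullet> d) / 2) *\<^sub>R mom_col N m k) - \<epsilon> *\<^sub>R d"
proof -
  have "mat \<epsilon> *v d = \<epsilon> *\<^sub>R d"
    by (simp add: matrix_vector_mult_def mat_def vec_eq_iff if_distrib[of "\<lambda>c. c * _"] cong: if_cong)
  moreover have "(- (1/2) *\<^sub>R (\<chi> i j. \<Sum>k\<in>grid N. mom_mat N m i k * u k * mom_mat N m j k)) *v d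
      = - (\<Sum>k\<in>grid N. (u k * (mom_col N m k \<bullet> d) / 2) *\<^sub>R mom_col N m k)"
    by (simp add: matrix_vector_mult_def vec_eq_iff mom_col_def inner_vec_def sum_distrib_left
        sum_distrib_right sum_divide_distrib sum_negf sum.swap[of _ UNIV "grid N"] mult_ac)
  ultimately show ?thesis
    unfolding newton_mat_def matrix_vector_mult_diff_rdistrib by simp
qed

theorem theorem6p1:
  fixes N :: nat
    and m :: "real^'d \<Rightarrow> real^'m"
    and f :: "real^'d \<Rightarrow> real"
    and \<tau>\<^sub>1 \<tau>\<^sub>2 \<mu> \<delta> :: real
    and lam :: "nat \<Rightarrow> real^'m"
  assumes "\<And>j. real_polynomial_function (\<lambda>x. m x $ j)"
    and "lin_indep_components m"
    and "\<exists>j c. c \<noteq> 0 \<and> (\<forall>x. m x $ j = c)"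
    and "\<And>x. f x \<ge> 0"
    and "periodic_2pi f"
    and "square_integrable_box f"
    and "slater N m f"
    and "0 < \<tau>\<^sub>1" "\<tau>\<^sub>1 < 1"
    and "0 < \<tau>\<^sub>2" "\<tau>\<^sub>2 < 1"
    and "0 < \<mu>" "\<mu> < 1/2"
    and "0 < \<delta>" "\<delta> < 1"
    and "ssn_sequence N m f \<tau>\<^sub>1 \<tau>\<^sub>2 \<mu> \<delta> lam"
  shows "range lam \<subseteq> Ran N m \<and> bounded (range lam) \<and>
    (\<forall>l. accumulation_point lam l \<longrightarrow> dual_solution N m f l) \<and>
    (\<forall>g. primal_minimizer N m f g \<longrightarrow>
       span (mom_col N m ` {k \<in> grid N. g k > 0}) = Ran N m \<longrightarrow>
       (\<exists>ls. dual_solution N m f ls \<and> lam \<longlonglongrightarrow> ls \<and>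
          (\<exists>C. \<forall>\<^sub>F j in sequentially. norm (lam (Suc j) - ls) \<le> C * (norm (lam j - ls))\<^sup>2)))"
proof -
  note slater = assms(7) and parameters = assms(8-15) and ssn = assms(16)
  obtain g where g_pos: "\<And>k. k \<in> grid N \<Longrightarrow> g (node N k) > 0"
    and g_sum: "cell_vol N TYPE('d) *\<^sub>R
      (\<Sum>k\<in>grid N. g (node N k) *\<^sub>R (\<chi> j. proj N (\<lambda>x. m x $ j) (node N k))) = rho m f"
    using slater unfolding slater_def by blast
  have col: "mom_col N m k = cell_vol N TYPE('d) *\<^sub>R (\<chi> j. proj N (\<lambda>x. m x $ j) (node N k))" for k
    by (simp add: mom_col_def mom_mat_def vec_eq_iff)
  have g_feasible: "(\<Sum>k\<in>grid N. g (node N k) *\<^sub>R mom_col N m k) = rho m f"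
    unfolding g_sum[symmetric] col scaleR_sum_right by (simp add: mult.commute)
  interpret D: piecewise_quadratic_dual "grid N" "mom_col N m" "fvec N f" "\<lambda>k. g (node N k)" "rho m f"
    by unfold_locales (auto simp: finite_grid g_pos g_feasible)
  have R: "D.R = Ran N m" by (simp add: D.R_def Ran_eq_span)
  have s: "shifted N m f l k = D.s l k" for l k
    by (simp add: shifted_def D.s_def mom_transpose_eq_inner)
  have Phi: "dual_obj N m f l = D.Phi l + (L2_set (fvec N f) (grid N))\<^sup>2" for l
    by (simp add: dual_obj_def D.Phi_def L2_set_def sum_nonneg pos_part_def s)
  have grad: "dual_grad N m f l = D.grad l" for l
    by (simp add: dual_grad_def D.grad_def mom_apply_eq_sum pos_part_def s)
  have H: "newton_mat N m (active N m f l) \<epsilon> *v d = - (D.H l d + \<epsilon> *\<^sub>R d)" for l \<epsilon> d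
  proof -
    have "(\<Sum>k\<in>grid N. (active N m f l k * (mom_col N m k \<bullet> d) / 2) *\<^sub>R mom_col N m k) = D.H l d"
      unfolding D.H_def by (intro sum.cong) (auto simp: active_def s)
    thus ?thesis by (simp add: newton_mat_mult_vec)
  qed
  have "\<exists>d n. \<forall>j. newton_direction N m f \<tau>\<^sub>1 \<tau>\<^sub>2 (lam j) (d j) \<and>
      armijo N m f \<mu> \<delta> (lam j) (d j) (n j) \<and> (\<forall>i<n j. \<not> armijo N m f \<mu> \<delta> (lam j) (d j) i) \<and>
      lam (Suc j) = lam j + \<delta> ^ n j *\<^sub>R d j"
    using ssn unfolding ssn_sequence_def by metis
  then obtain dir n where iter: "\<And>j. newton_direction N m f \<tau>\<^sub>1 \<tau>\<^sub>2 (lam j) (dir j)"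
      "\<And>j. armijo N m f \<mu> \<delta> (lam j) (dir j) (n j)"
      "\<And>j. \<forall>i<n j. \<not> armijo N m f \<mu> \<delta> (lam j) (dir j) i"
      "\<And>j. lam (Suc j) = lam j + \<delta> ^ n j *\<^sub>R dir j"
    by blast
  have "lam 0 = 0" using ssn by (simp add: ssn_sequence_def)
  then interpret I: newton_iteration "grid N" "mom_col N m" "fvec N f" "\<lambda>k. g (node N k)" "rho m f"
      \<tau>\<^sub>1 \<tau>\<^sub>2 \<mu> \<delta> lam dir n
  proof (unfold_locales, goal_cases)
    \<comment> \<open>Goals 1 to 9 are the parameter bounds and the initial value, goal 14 is the
      update; only the four between need translation.\<close>
    case (10 j)
    show ?case using iter(1)[of j] by (simp add: newton_direction_def R)
  next
    case (11 j)
    show ?case using iter(1)[of j] unfolding newton_direction_def grad H neg_equal_iff_equal by blast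
  next
    case (12 j)
    show ?case using iter(2)[of j] by (simp add: armijo_def grad Phi)
  next
    case (13 j)
    show ?case using iter(3)[of j] by (simp add: armijo_def grad Phi)
  qed (use parameters iter(4) in simp_all)
  have optimal: "dual_solution N m f l" if "l \<in> D.R" "D.grad l = 0" for l
    using that D.Phi_le_tangent[of _ l]
    by (auto simp: dual_solution_def is_arg_max_def Phi R[symmetric] not_less)
  have part1: "range lam \<subseteq> Ran N m" using I.lam_R R by auto
  have part3: "dual_solution N m f l" if "accumulation_point lam l" for l
    using optimal I.accumulation_point_stationary[OF that] .
  have part4: "\<exists>ls. dual_solution N m f ls \<and> lam \<longlonglongrightarrow> ls \<and>
      (\<exists>C. \<forall>\<^sub>F j in sequentially. norm (lam (Suc j) - ls) \<le> C * (norm (lam j - ls))\<^sup>2)"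
    if h: "primal_minimizer N m f h" and spanning: "span (mom_col N m ` {k \<in> grid N. h k > 0}) = Ran N m" for h
  proof -
    obtain ls where acc: "accumulation_point lam ls" using I.ex_accumulation_point by blast
    note stat = I.accumulation_point_stationary[OF acc]
    \<comment> \<open>The primal point recovered from the multiplier \<open>ls\<close>;
      \<open>grad ls = 0\<close> is its moment constraint. The restriction makes it extensional, as
      feasibility demands.\<close>
    let ?p = "restrict (\<lambda>k. max 0 (D.s ls k)) (grid N)"
    have "primal_feasible N m f ?p"
      using stat(2) by (auto simp: primal_feasible_def mom_apply_eq_sum D.grad_def)
    with h have "\<not> (L2_set (\<lambda>k. ?p k - fvec N f k) (grid N))\<^sup>2 < (L2_set (\<lambda>k. h k - fvec N f k) (grid N))\<^sup>2"
      unfolding primal_minimizer_def is_arg_min_def by metis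
    hence opt: "(\<Sum>k\<in>grid N. (h k - fvec N f k)\<^sup>2) \<le> (\<Sum>k\<in>grid N. (max 0 (D.s ls k) - fvec N f k)\<^sup>2)"
      by (simp add: L2_set_def sum_nonneg not_less)
    have h': "\<And>k. k \<in> grid N \<Longrightarrow> h k \<ge> 0" "(\<Sum>k\<in>grid N. h k *\<^sub>R mom_col N m k) = rho m f"
      using h by (auto simp: primal_minimizer_def is_arg_min_def primal_feasible_def mom_apply_eq_sum
          dest: PiE_mem)
    \<comment> \<open>The primal support is the active set at \<open>ls\<close>, so the spanning
      assumption becomes the curvature condition of the local analysis.\<close>
    have "{k \<in> grid N. h k > 0} = {k \<in> grid N. D.s ls k > 0}"
      using D.stationary_imp_primal_unique[OF stat(2) h' opt] by (auto simp: max_def split: if_splits)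
    hence "span (mom_col N m ` {k \<in> grid N. D.s ls k > 0}) = D.R" using spanning R by simp
    from I.quadratic_convergence[OF acc this] part3[OF acc] show ?thesis by blast
  qed
  show ?thesis using part1 I.bounded_lam part3 part4 by blast
qed

end
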